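(* Let $q$ be a prime power, $n=tt'$ with integers $t,t'\ge2$, and $f(x)=\sum_{i=0}^{n-1}a_ix^{q^i}\in\mathbb{F}_{q^n}[x]$. For $\sigma\in\mathbb{F}_{q^n}^*$ let $f_{t,\sigma}\colon\mathbb{F}_{q^t}\to\mathbb{F}_{q^n}$, $x\mapsto f(\sigma x)$. (a) Let $k$ be a non-negative integer. Then $f$ is R-$q^t$-partially scattered if and only if, for every $\sigma\in\mathbb{F}_{q^n}^*$, the code $\mathcal C_{f,\sigma,k}=\{\alpha f_{t,\sigma}(x)+\beta x^{q^{kt}}\colon\alpha,\beta\in\mathbb{F}_{q^n}\}$ of $\mathbb{F}_q$-linear maps $\mathbb{F}_{q^t}\to\mathbb{F}_{q^n}$ is an MRD-code with parameters $(n,t,q;t-1)$. (b) Assume $t=t'=2$ (so $n=4$). A $q$-polynomial $f(x)$ over $\mathbb{F}_{q^4}$ is R-$q^2$-partially scattered if and only if $\mathcal C=\{\alpha f(x)+\beta x+\gamma x^{q^2}\colon\alpha,\beta,\gamma\in\mathbb{F}_{q^4}\}$ is an MRD-code with parameters $(4,4,q;2)$.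
   Context: A $q$-polynomial $f$ over $\mathbb{F}_{q^n}$ is R-$q^t$-partially scattered if for all $y,z\in\mathbb{F}_{q^n}^*$, $f(y)/y=f(z)/z$ and $y/z\in\mathbb{F}_{q^t}$ imply $y/z\in\mathbb{F}_q$. $\mathbb{F}_q$-linear maps $\mathbb{F}_{q^t}\to\mathbb{F}_{q^n}$ are identified with matrices in $\mathbb{F}_q^{n\times t}$ (and endomorphisms of $\mathbb{F}_{q^4}$ with $\mathbb{F}_q^{4\times4}$). An $\mathbb{F}_q$-linear rank metric code $\mathcal C\subseteq\mathbb{F}_q^{\ell\times m}$ with minimum rank distance $d$ satisfies $\dim_{\mathbb{F}_q}\mathcal C\le\max\{\ell,m\}(\min\{\ell,m\}-d+1)$; it is an MRD-code with parameters $(\ell,m,q;d)$ if its minimum distance is $d$ and equality holds. *)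

theory Defs
  imports "HOL-Number_Theory.Prime_Powers" "HOL-Computational_Algebra.Polynomial"
    "HOL-Library.Function_Algebras" "HOL-Library.Cardinality"
begin

text \<open>
  The fields of order q, \<open>q^t\<close> and \<open>q^n\<close> are three finite field types \<open>'k\<close>, \<open>'l\<close>, \<open>'a\<close>
  with embeddings \<open>'k \<Rightarrow> 'l \<Rightarrow> 'a\<close>. The smaller fields, as subfields of \<open>'a\<close>, are the ranges of
  these embeddings; the \<open>'k\<close>-vector space structures are given by restriction of scalars.
\<close>

definition field_embedding :: "('b::field \<Rightarrow> 'c::field) \<Rightarrow> bool" where
  "field_embedding h \<longleftrightarrow>
     h 1 = 1 \<and> (\<forall>x y. h (x + y) = h x + h y) \<and> (\<forall>x y. h (x * y) = h x * h y)"

definition emb_scale :: "('b::field \<Rightarrow> 'c::field) \<Rightarrow> 'b \<Rightarrow> 'c \<Rightarrow> 'c" where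
  "emb_scale h c x = h c * x"

definition fun_scale :: "('k \<Rightarrow> 'w \<Rightarrow> 'w) \<Rightarrow> 'k \<Rightarrow> ('v \<Rightarrow> 'w) \<Rightarrow> 'v \<Rightarrow> 'w" where
  "fun_scale s c g = (\<lambda>x. s c (g x))"

lemma vector_space_emb_scale:
  assumes "field_embedding h"
  shows "vector_space (emb_scale h)"
  using assms by unfold_locales (auto simp: field_embedding_def emb_scale_def algebra_simps)

lemma vector_space_fun_scale:
  assumes "vector_space s"
  shows "vector_space (fun_scale s :: 'k::field \<Rightarrow> ('v \<Rightarrow> 'w::ab_group_add) \<Rightarrow> 'v \<Rightarrow> 'w)"
proof -
  interpret vector_space s by fact
  show ?thesis
    by unfold_locales (auto simp: fun_scale_def fun_eq_iff scale_right_distrib scale_left_distrib)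
qed

definition q_polynomial :: "nat \<Rightarrow> 'a::comm_semiring_1 poly \<Rightarrow> bool" where
  "q_polynomial q f \<longleftrightarrow> (\<exists>(m::nat) a. f = (\<Sum>i<m. monom (a i) (q ^ i)))"

text \<open>
  \<open>Fq\<close> and \<open>Fqt\<close> are the subfields of order q and \<open>q^t\<close> of \<open>'a\<close>.
\<close>

definition R_partially_scattered :: "'a set \<Rightarrow> 'a set \<Rightarrow> 'a::field poly \<Rightarrow> bool" where
  "R_partially_scattered Fq Fqt f \<longleftrightarrow>
     (\<forall>y z. y \<noteq> 0 \<longrightarrow> z \<noteq> 0 \<longrightarrow> poly f y / y = poly f z / z \<longrightarrow> y / z \<in> Fqt \<longrightarrow> y / z \<in> Fq)"

definition rank_dist :: "('k::field \<Rightarrow> 'w \<Rightarrow> 'w) \<Rightarrow> ('v \<Rightarrow> 'w) \<Rightarrow> ('v \<Rightarrow> 'w::ab_group_add) \<Rightarrow> nat" where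
  "rank_dist s2 g h = vector_space.dim s2 (range (g - h))"

definition has_min_rank_dist ::
    "('k::field \<Rightarrow> 'w \<Rightarrow> 'w) \<Rightarrow> ('v \<Rightarrow> 'w::ab_group_add) set \<Rightarrow> nat \<Rightarrow> bool" where
  "has_min_rank_dist s2 C d \<longleftrightarrow>
     (\<exists>g\<in>C. \<exists>h\<in>C. g \<noteq> h \<and> rank_dist s2 g h = d) \<and>
     (\<forall>g\<in>C. \<forall>h\<in>C. g \<noteq> h \<longrightarrow> d \<le> rank_dist s2 g h)"

text \<open>
  \<open>MRD_code s1 s2 (l, m, q, d) C\<close>: a set \<open>C\<close> of linear maps from an m-dimensional to an
  l-dimensional space over the field \<open>'k\<close> of order q, i.e. of \<open>l \<times> m\<close> matrices over \<open>'k\<close> after a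
  choice of bases, is a \<open>'k\<close>-linear MRD code with parameters \<open>(l, m, q; d)\<close>. The truncated
  subtraction is harmless, since a minimum distance is at most \<open>min l m\<close>.
\<close>

definition MRD_code ::
    "('k::{field,finite} \<Rightarrow> 'v \<Rightarrow> 'v) \<Rightarrow> ('k \<Rightarrow> 'w \<Rightarrow> 'w) \<Rightarrow> nat \<times> nat \<times> nat \<times> nat
      \<Rightarrow> ('v::ab_group_add \<Rightarrow> 'w::ab_group_add) set \<Rightarrow> bool" where
  "MRD_code s1 s2 = (\<lambda>(l, m, q, d) C.
     CARD('k) = q \<and> vector_space.dim s1 (UNIV :: 'v set) = m \<and>
     vector_space.dim s2 (UNIV :: 'w set) = l \<and>
     (\<forall>g\<in>C. Vector_Spaces.linear s1 s2 g) \<and>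
     module.subspace (fun_scale s2) C \<and>
     has_min_rank_dist s2 C d \<and>
     vector_space.dim (fun_scale s2) C = max l m * (min l m - d + 1))"

definition f_sub :: "('l \<Rightarrow> 'a) \<Rightarrow> 'a::field poly \<Rightarrow> 'a \<Rightarrow> 'l \<Rightarrow> 'a" where
  "f_sub j f \<sigma> = (\<lambda>x. poly f (\<sigma> * j x))"

definition code_sub ::
    "nat \<Rightarrow> nat \<Rightarrow> ('l \<Rightarrow> 'a) \<Rightarrow> 'a::field poly \<Rightarrow> 'a \<Rightarrow> nat \<Rightarrow> ('l \<Rightarrow> 'a) set" where
  "code_sub q t j f \<sigma> k =
     {(\<lambda>x. \<alpha> * f_sub j f \<sigma> x + \<beta> * j x ^ (q ^ (k * t))) | \<alpha> \<beta>. True}"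

definition code_full :: "nat \<Rightarrow> 'a::field poly \<Rightarrow> ('a \<Rightarrow> 'a) set" where
  "code_full q f = {(\<lambda>x. \<alpha> * poly f x + \<beta> * x + \<gamma> * x ^ (q ^ 2)) | \<alpha> \<beta> \<gamma>. True}"

end

theory Submission
  imports Defs
begin

text \<open>
  By rank-nullity over a finite field, the MRD property only concerns cardinalities: a code has
  the right size iff its parametrization by the coefficients is injective, and a rank is bounded
  below iff the kernel has few elements. For (a), two vectors in the kernel of
  \<open>\<alpha> f(\<sigma> x) + \<beta> x\<close> with \<open>\<alpha> \<noteq> 0\<close> are exactly two elements of \<open>\<sigma> F\<^bsub>q^t\<^esub>\<close> on which
  \<open>f(x)/x\<close> takes the same value. For (b), a kernel of dimension at least 3 in \<open>F\<^bsub>q^4\<^esub>\<close> contains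
  a line \<open>s F\<^bsub>q^2\<^esub>\<close>, on which \<open>\<beta> x + \<gamma> x\<^bsup>q^2\<^esup>\<close> is \<open>F\<^bsub>q^2\<^esub>\<close>-linear and hence so is \<open>f\<close>;
  conversely, if \<open>f\<close> is \<open>F\<^bsub>q^2\<^esub>\<close>-linear on such a line, then suitable \<open>\<beta>, \<gamma>\<close> produce a code word
  vanishing on that line and at one more point.
\<close>

section \<open>Dimensions, kernels and MRD-codes by counting\<close>

lemma two_le_CARD_field: "2 \<le> CARD('a::{field,finite})"
proof -
  have "card {0, 1 :: 'a} \<le> CARD('a)"
    by (intro card_mono) auto
  then show ?thesis
    by simp
qed

text \<open>Induction on a basis: adjoining an independent vector \<open>b\<close> multiplies the
  size of the span by \<open>CARD('k)\<close>, because each new element is \<open>s c b + x\<close>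
  for exactly one pair of a scalar \<open>c\<close> and an old element \<open>x\<close>.\<close>

lemma card_eq_power_dim:
  fixes s :: "'k::{field,finite} \<Rightarrow> 'b::ab_group_add \<Rightarrow> 'b"
  assumes "vector_space s" and "module.subspace s S" and "finite S"
  shows "card S = CARD('k) ^ vector_space.dim s S"
proof -
  interpret vector_space s by fact
  have span: "finite (span B) \<and> card (span B) = CARD('k) ^ card B"
    if "finite B" "independent B" for B
    using that
  proof (induction B rule: finite_induct)
    case (insert b B)
    have IH: "finite (span B)" "card (span B) = CARD('k) ^ card B"
      using insert.IH independent_mono[OF insert.prems, of B] by auto
    have notin: "b \<notin> span B"
      using insert by (simp add: independent_insert)
    have *: "span (insert b B) = (\<lambda>(c, x). s c b + x) ` (UNIV \<times> span B)"
    proof (intro set_eqI iffI)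
      fix y assume "y \<in> span (insert b B)"
      then obtain k where "y - s k b \<in> span B"
        by (auto simp: span_insert)
      then show "y \<in> (\<lambda>(c, x). s c b + x) ` (UNIV \<times> span B)"
        by (intro image_eqI[of _ _ "(k, y - s k b)"]) auto
    next
      fix y assume "y \<in> (\<lambda>(c, x). s c b + x) ` (UNIV \<times> span B)"
      then obtain c x where "y = s c b + x" "x \<in> span B"
        by auto
      then show "y \<in> span (insert b B)"
        by (auto simp: span_insert intro!: exI[of _ c])
    qed
    have "inj_on (\<lambda>(c, x). s c b + x) (UNIV \<times> span B)"
    proof (rule inj_onI, clarify)
      fix c x c' x' assume x: "x \<in> span B" "x' \<in> span B" and eq: "s c b + x = s c' b + x'"
      have "s (c - c') b = x' - x"
        using eq by (simp add: scale_left_diff_distrib algebra_simps)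
      then have mem: "s (c - c') b \<in> span B"
        using x by (simp add: span_diff)
      have "c = c'"
      proof (rule ccontr)
        assume "c \<noteq> c'"
        moreover have "s (inverse (c - c')) (s (c - c') b) \<in> span B"
          using mem by (rule span_scale)
        ultimately show False
          using notin by simp
      qed
      then show "c = c' \<and> x = x'"
        using eq by simp
    qed
    then show ?case
      unfolding * using IH insert.hyps by (simp add: card_image card_cartesian_product)
  qed simp
  obtain B where B: "B \<subseteq> S" "independent B" "S \<subseteq> span B" "card B = dim S"
    by (rule basis_exists)
  have "span B = S"
    using B(1,3) assms(2) by (rule span_subspace)
  then show ?thesis
    using span[of B] B assms(3) finite_subset by metis
qed

text \<open>Rank-nullity in multiplicative form: every nonempty fiber is a translate of the kernel,
  and the fibers partition the domain.\<close>

lemma card_range_times_card_kernel: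
  fixes g :: "'v::{ab_group_add,finite} \<Rightarrow> 'w::ab_group_add"
  assumes add: "\<And>x y. g (x + y) = g x + g y"
  shows "card (range g) * card {x. g x = 0} = CARD('v)"
proof -
  have diff: "g (x - y) = g x - g y" for x y
    using add[of "x - y" y] by (simp add: algebra_simps)
  have fiber: "card {x. g x = y} = card {x. g x = 0}" if y: "y \<in> range g" for y
  proof -
    obtain a where a: "y = g a"
      using y by auto
    show ?thesis
      by (rule bij_betw_same_card[of "\<lambda>x. x - a"], rule bij_betw_byWitness[where f' = "\<lambda>x. x + a"])
        (auto simp: a add diff)
  qed
  have "CARD('v) = card (\<Union>y\<in>range g. {x. g x = y})"
    by (rule arg_cong[where f = card]) auto
  also have "\<dots> = (\<Sum>y\<in>range g. card {x. g x = y})"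
    by (rule card_UN_disjoint) auto
  also have "\<dots> = (\<Sum>y\<in>range g. card {x. g x = 0})"
    using fiber by (intro sum.cong) auto
  finally show ?thesis
    by simp
qed

text \<open>In a linear code the minimum distance is the minimum rank of a nonzero word, and rank
  \<open>d\<close> amounts to a kernel of size \<open>q ^ (m - d)\<close>. This removes all
  dimensions from the later arguments.\<close>

lemma MRD_code_iff_card_kernel:
  fixes s1 :: "'k::{field,finite} \<Rightarrow> 'v::{ab_group_add,finite} \<Rightarrow> 'v"
    and s2 :: "'k \<Rightarrow> 'w::{ab_group_add,finite} \<Rightarrow> 'w"
  assumes vs: "vector_space s1" "vector_space s2"
    and cards: "CARD('k) = q" "CARD('v) = q ^ m" "CARD('w) = q ^ l"
    and lin: "\<And>g. g \<in> C \<Longrightarrow> Vector_Spaces.linear s1 s2 g"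
    and sub: "module.subspace (fun_scale s2) C" and "d \<le> m"
  shows "MRD_code s1 s2 (l, m, q, d) C \<longleftrightarrow>
    card C = q ^ (max l m * (min l m - d + 1)) \<and>
    (\<exists>g\<in>C. g \<noteq> 0 \<and> card {x. g x = 0} = q ^ (m - d)) \<and>
    (\<forall>g\<in>C. g \<noteq> 0 \<longrightarrow> card {x. g x = 0} \<le> q ^ (m - d))"
proof -
  interpret s1: vector_space s1 by fact
  interpret s2: vector_space s2 by fact
  interpret F: vector_space "fun_scale s2 :: 'k \<Rightarrow> ('v \<Rightarrow> 'w) \<Rightarrow> 'v \<Rightarrow> 'w"
    using vs(2) by (rule vector_space_fun_scale)
  have q: "q > 1"
    using two_le_CARD_field[where 'a = 'k] cards(1) by simp
  have dim1: "s1.dim UNIV = m"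
    using card_eq_power_dim[OF vs(1) s1.subspace_UNIV] cards q by simp
  have dim2: "s2.dim UNIV = l"
    using card_eq_power_dim[OF vs(2) s2.subspace_UNIV] cards q by simp
  have dimC: "F.dim C = r \<longleftrightarrow> card C = q ^ r" for r
    using card_eq_power_dim[OF F.vector_space_axioms sub] cards q by simp
  \<comment> \<open>The domain size \<open>q ^ m\<close> is split as
    \<open>q ^ d * q ^ (m - d)\<close>, so that comparing the rank with \<open>d\<close> becomes
    cancelling a common factor.\<close>
  have ker: "q ^ s2.dim (range g) * card {x. g x = 0} = q ^ d * q ^ (m - d)" if "g \<in> C" for g
  proof -
    interpret g: Vector_Spaces.linear s1 s2 g
      using that by (rule lin)
    have "card (range g) = q ^ s2.dim (range g)"
      using card_eq_power_dim[OF vs(2) g.subspace_image[OF s1.subspace_UNIV]] cards by simp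
    then show ?thesis
      using card_range_times_card_kernel[of g] g.add cards \<open>d \<le> m\<close>
      by (simp flip: power_add)
  qed
  have eq: "s2.dim (range g) = d \<longleftrightarrow> card {x. g x = 0} = q ^ (m - d)" if "g \<in> C" for g
  proof
    assume "card {x. g x = 0} = q ^ (m - d)"
    then show "s2.dim (range g) = d"
      using ker[OF that] q by simp
  qed (use ker[OF that] q in simp)
  have le: "d \<le> s2.dim (range g) \<longleftrightarrow> card {x. g x = 0} \<le> q ^ (m - d)" if "g \<in> C" for g
  proof
    assume "d \<le> s2.dim (range g)"
    then have "q ^ d * card {x. g x = 0} \<le> q ^ d * q ^ (m - d)"
      unfolding ker[OF that, symmetric] using q by (intro mult_right_mono power_increasing) auto
    then show "card {x. g x = 0} \<le> q ^ (m - d)"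
      using q by simp
  next
    assume "card {x. g x = 0} \<le> q ^ (m - d)"
    then have "q ^ d * q ^ (m - d) \<le> q ^ s2.dim (range g) * q ^ (m - d)"
      unfolding ker[OF that, symmetric] by (intro mult_left_mono) auto
    then show "d \<le> s2.dim (range g)"
      using q by simp
  qed
  have diff: "g - h \<in> C" if "g \<in> C" "h \<in> C" for g h
    using sub that by (rule F.subspace_diff)
  have zero: "0 \<in> C"
    using sub by (rule F.subspace_0)
  \<comment> \<open>\<open>C\<close> is closed under differences; conversely, a nonzero word is its
    own difference to \<open>0\<close>.\<close>
  have ex: "(\<exists>g\<in>C. \<exists>h\<in>C. g \<noteq> h \<and> P (g - h)) \<longleftrightarrow> (\<exists>g\<in>C. g \<noteq> 0 \<and> P g)" for P
    using diff zero by (metis diff_zero right_minus_eq)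
  have all: "(\<forall>g\<in>C. \<forall>h\<in>C. g \<noteq> h \<longrightarrow> P (g - h)) \<longleftrightarrow> (\<forall>g\<in>C. g \<noteq> 0 \<longrightarrow> P g)" for P
    using ex[of "\<lambda>g. \<not> P g"] by blast
  have "has_min_rank_dist s2 C d \<longleftrightarrow>
      (\<exists>g\<in>C. g \<noteq> 0 \<and> card {x. g x = 0} = q ^ (m - d)) \<and>
      (\<forall>g\<in>C. g \<noteq> 0 \<longrightarrow> card {x. g x = 0} \<le> q ^ (m - d))"
    unfolding has_min_rank_dist_def rank_dist_def
      ex[of "\<lambda>g. s2.dim (range g) = d"] all[of "\<lambda>g. d \<le> s2.dim (range g)"]
    using eq le by auto
  then show ?thesis
    unfolding MRD_code_def using cards lin sub dim1 dim2 dimC by auto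
qed

section \<open>Finite fields, subfields and \<open>q\<close>-polynomials\<close>

lemma field_embedding_simps:
  assumes "field_embedding h"
  shows "h 1 = 1" "h (x + y) = h x + h y" "h (x * y) = h x * h y" "h 0 = 0"
    "h x = 0 \<longleftrightarrow> x = 0" "h (x ^ m) = h x ^ m" "inj h"
proof -
  have add: "h (x + y) = h x + h y" and mult: "h (x * y) = h x * h y" and one: "h 1 = 1" for x y
    using assms by (auto simp: field_embedding_def)
  show "h 1 = 1" "h (x + y) = h x + h y" "h (x * y) = h x * h y"
    by (rule one add mult)+
  show zero: "h 0 = 0"
    using add[of 0 0] by (simp only: add_0_left add_cancel_right_left)
  have eq0: "h x = 0 \<longleftrightarrow> x = 0" for x
    using mult[of x "inverse x"] one zero by (cases "x = 0") auto
  then show "h x = 0 \<longleftrightarrow> x = 0" .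
  show "h (x ^ m) = h x ^ m"
    by (induction m) (simp_all add: one mult)
  show "inj h"
  proof (rule injI)
    fix x y assume "h x = h y"
    then have "h (x - y) = 0"
      using add[of "x - y" y] by simp
    then show "x = y"
      by (simp add: eq0)
  qed
qed

text \<open>
  \<open>finite_field_power_card_eq_same\<close> needs the class \<open>finite_field\<close>, which the sort
  \<open>{field, finite}\<close> does not entail for the type checker.
\<close>
lemma power_CARD_eq_self:
  fixes x :: "'a::{field,finite}"
  shows "x ^ CARD('a) = x"
proof (cases "x = 0")
  case False
  \<comment> \<open>Multiplication by \<open>x\<close> permutes the nonzero elements, so their
    product \<open>?P\<close> equals \<open>x ^ (CARD('a) - 1) * ?P\<close>, and the nonzero
    \<open>?P\<close> cancels.\<close>
  let ?P = "\<Prod>(UNIV - {0 :: 'a})"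
  have "(\<lambda>y. x * y) ` (UNIV - {0}) = UNIV - {0}"
    using False by (auto intro!: image_eqI[of _ _ "_ / x"])
  then have "?P = prod id ((\<lambda>y. x * y) ` (UNIV - {0}))"
    by simp
  also have "\<dots> = x ^ (CARD('a) - 1) * ?P"
    using False by (subst prod.reindex) (auto simp: inj_on_def prod.distrib)
  finally have "x ^ (CARD('a) - 1) = 1"
    by simp
  then show ?thesis
    using power_minus_mult[of "CARD('a)" x] by simp
qed simp

text \<open>The image consists of \<open>CARD('l)\<close> roots of \<open>?p\<close>, which has
  degree at most \<open>CARD('l)\<close>, so there are no further roots. This turns membership in a
  subfield into an equation.\<close>

lemma range_field_embedding:
  fixes h :: "'l::{field,finite} \<Rightarrow> 'a::field"
  assumes "field_embedding h"
  shows "range h = {x. x ^ CARD('l) = x}"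
proof -
  let ?p = "monom 1 CARD('l) - monom 1 1 :: 'a poly"
  have card: "2 \<le> CARD('l)"
    by (rule two_le_CARD_field)
  have "coeff ?p CARD('l) = 1"
    using card by simp
  then have "?p \<noteq> 0"
    by (metis coeff_0 zero_neq_one)
  have roots: "{x. x ^ CARD('l) = x} = {x. poly ?p x = 0}"
    by (simp add: poly_monom)
  have "degree ?p \<le> CARD('l)"
    using card by (intro degree_diff_le) (auto intro: degree_monom_le order_trans)
  then have "card {x. poly ?p x = 0} \<le> card (range h)"
    using card_poly_roots_bound[OF \<open>?p \<noteq> 0\<close>] field_embedding_simps(7)[OF assms]
    by (simp add: card_image)
  moreover have "range h \<subseteq> {x. poly ?p x = 0}"
    unfolding roots[symmetric]
    using power_CARD_eq_self[where 'a = 'l] by (auto simp flip: field_embedding_simps(6)[OF assms])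
  ultimately show ?thesis
    unfolding roots using poly_roots_finite[OF \<open>?p \<noteq> 0\<close>] by (intro card_seteq)
qed

text \<open>Translation by 1 permutes the field, so the sum of all elements does not change when 1
  is added to each of them.\<close>

lemma CHAR_dvd_CARD: "CHAR('a::{field,finite}) dvd CARD('a)"
proof -
  have "(\<Sum>x\<in>UNIV. x :: 'a) = (\<Sum>x\<in>UNIV. x + 1)"
    by (rule sum.reindex_bij_witness[of _ "\<lambda>x. x + 1" "\<lambda>x. x - 1"]) auto
  then have "of_nat CARD('a) = (0 :: 'a)"
    by (simp add: sum.distrib)
  then show ?thesis
    by (simp add: of_nat_eq_0_iff_char_dvd)
qed

text \<open>The characteristic is a prime dividing \<open>q ^ n\<close>, hence the prime underlying
  \<open>q\<close>; the map is thus an iterate of the Frobenius endomorphism.\<close>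

lemma frobenius_add:
  fixes x y :: "'a::{field,finite}"
  assumes "primepow q" and "CARD('a) = q ^ n"
  shows "(x + y) ^ (q ^ i) = x ^ (q ^ i) + y ^ (q ^ i)"
proof -
  have prime: "prime CHAR('a)"
    by (intro prime_CHAR_semidom finite_imp_CHAR_pos) simp
  obtain p e where p: "prime p" "q = p ^ e"
    using assms(1) by (auto simp: primepow_def)
  have "CHAR('a) dvd p ^ (e * n)"
    using CHAR_dvd_CARD[where 'a = 'a] assms(2) p by (simp add: power_mult)
  then have "CHAR('a) = p"
    using prime p prime_dvd_power primes_dvd_imp_eq by blast
  then show ?thesis
    using prime p by (intro freshmans_dream'[where n = "e * i"]) (auto simp: power_mult)
qed

lemma q_polynomial_add:
  fixes f :: "'a::{field,finite} poly"
  assumes "primepow q" and "CARD('a) = q ^ n" and "q_polynomial q f"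
  shows "poly f (x + y) = poly f x + poly f y"
proof -
  obtain m :: nat and a where f: "f = (\<Sum>i<m. monom (a i) (q ^ i))"
    using assms(3) by (auto simp: q_polynomial_def)
  show ?thesis
    unfolding f by (simp add: poly_sum poly_monom frobenius_add[OF assms(1,2)] sum.distrib algebra_simps)
qed

lemma q_polynomial_scale:
  fixes c :: "'a::field"
  assumes "q_polynomial q f" and c: "c ^ q = c"
  shows "poly f (c * x) = c * poly f x"
proof -
  obtain m :: nat and a where f: "f = (\<Sum>i<m. monom (a i) (q ^ i))"
    using assms(1) by (auto simp: q_polynomial_def)
  have "c ^ (q ^ i) = c" for i
    by (induction i) (simp_all add: c power_mult)
  then show ?thesis
    unfolding f by (simp add: poly_sum poly_monom power_mult_distrib sum_distrib_left mult.left_commute)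
qed

section \<open>Towers of three finite fields\<close>

locale field_tower =
  fixes q t n :: nat
    and \<iota> :: "'k::{field,finite} \<Rightarrow> 'l::{field,finite}"
    and j :: "'l \<Rightarrow> 'a::{field,finite}"
  assumes q: "primepow q"
    and cards: "CARD('k) = q" "CARD('l) = q ^ t" "CARD('a) = q ^ n"
    and emb: "field_embedding \<iota>" "field_embedding j"
begin

lemmas iota = field_embedding_simps[OF emb(1)]
lemmas j = field_embedding_simps[OF emb(2)]

lemma emb_comp: "field_embedding (j \<circ> \<iota>)"
  by (simp add: field_embedding_def iota j)

lemma vector_spaces:
  "vector_space (emb_scale \<iota>)" "vector_space (emb_scale (j \<circ> \<iota>))"
  by (intro vector_space_emb_scale emb emb_comp)+

lemma q_gt_1: "1 < q"
  using primepow_gt_Suc_0[OF q] by simp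

text \<open>This is why the parameter \<open>k\<close> has no effect on the code in (a).\<close>

lemma j_power_multiple: "j x ^ (q ^ (k * t)) = j x"
proof -
  have "x ^ (q ^ t) ^ k = x"
    using power_CARD_eq_self[of x] cards(2) by (induction k) (simp_all add: power_mult)
  then show ?thesis
    by (simp flip: j(6) power_mult add: mult.commute)
qed

lemma Fq_power: "j (\<iota> c) ^ (q ^ i) = j (\<iota> c)"
proof -
  have "c ^ (q ^ i) = c"
    using power_CARD_eq_self[of c] cards(1) by (induction i) (simp_all add: power_mult)
  then show ?thesis
    by (simp flip: j(6) iota(6))
qed

lemma q_polynomial_Fq_scale:
  assumes "q_polynomial q f"
  shows "poly f (j (\<iota> c) * x) = j (\<iota> c) * poly f x"
  using q_polynomial_scale[OF assms] Fq_power[of c 1] by simp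

text \<open>Two nonzero elements have quotient in \<open>range j\<close> exactly when they lie on a
  common line \<sigma> * \<open>range j\<close>. Grouping the pairs by \<sigma> matches the codes of
  (a), and clearing denominators matches equations for kernels.\<close>

lemma R_partially_scattered_iff:
  "R_partially_scattered (range (j \<circ> \<iota>)) (range j) f \<longleftrightarrow>
    (\<forall>\<sigma>. \<sigma> \<noteq> 0 \<longrightarrow> (\<forall>x y. x \<noteq> 0 \<longrightarrow>
      poly f (\<sigma> * j y) * j x = poly f (\<sigma> * j x) * j y \<longrightarrow> y / x \<in> range \<iota>))"
  (is "_ \<longleftrightarrow> ?R")
proof
  assume *: "R_partially_scattered (range (j \<circ> \<iota>)) (range j) f"
  show ?R
  proof (intro allI impI)
    fix \<sigma> x y
    assume \<sigma>: "\<sigma> \<noteq> 0" and x: "x \<noteq> 0"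
      and eq: "poly f (\<sigma> * j y) * j x = poly f (\<sigma> * j x) * j y"
    show "y / x \<in> range \<iota>"
    \<comment> \<open>The definition compares nonzero arguments only; for \<open>y = 0\<close> the
      quotient 0 lies in every subfield.\<close>
    proof (cases "y = 0")
      case True
      then show ?thesis
        using iota(4) by (metis div_0 rangeI)
    next
      case False
      have "j y = j (y / x) * j x"
        using x by (simp flip: j(3))
      then have quot: "\<sigma> * j y / (\<sigma> * j x) = j (y / x)"
        using \<sigma> x by (simp add: j(5))
      have "poly f (\<sigma> * j y) / (\<sigma> * j y) = poly f (\<sigma> * j x) / (\<sigma> * j x)"
        using \<sigma> x False eq by (simp add: j(5) field_simps)
      then have "\<sigma> * j y / (\<sigma> * j x) \<in> range (j \<circ> \<iota>)"
        using * \<sigma> x False quot unfolding R_partially_scattered_def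
        by (metis j(5) mult_eq_0_iff rangeI)
      then show ?thesis
        unfolding quot using j(7) by (auto dest: injD)
    qed
  qed
next
  assume R: ?R
  show "R_partially_scattered (range (j \<circ> \<iota>)) (range j) f"
    unfolding R_partially_scattered_def
  proof (intro allI impI)
    fix y z assume y: "y \<noteq> 0" and z: "z \<noteq> 0" and eq: "poly f y / y = poly f z / z"
      and "y / z \<in> range j"
    then obtain c where c: "y / z = j c"
      by auto
    have "poly f y = poly f z * (y / z)"
      using eq y z by (simp add: field_simps)
    \<comment> \<open>The line through \<open>z\<close> is parametrized with \<sigma> =
      \<open>z\<close>, so \<open>z\<close> and \<open>y\<close> become the points 1 and
      \<open>c\<close>.\<close>
    then have "poly f (z * j c) * j 1 = poly f (z * j 1) * j c"
      using z by (simp add: j(1) flip: c)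
    then have "c / 1 \<in> range \<iota>"
      using R \<open>z \<noteq> 0\<close> by (metis zero_neq_one)
    then show "y / z \<in> range (j \<circ> \<iota>)"
      using c by auto
  qed
qed

section \<open>Codes of maps from the middle field to the top field\<close>

lemma MRD_code_sub_iff:
  assumes t: "2 \<le> t" "t \<le> n" and f: "q_polynomial q f" and "\<sigma> \<noteq> 0"
  shows "MRD_code (emb_scale \<iota>) (emb_scale (j \<circ> \<iota>)) (n, t, q, t - 1) (code_sub q t j f \<sigma> k) \<longleftrightarrow>
    (\<forall>x y. x \<noteq> 0 \<longrightarrow> poly f (\<sigma> * j y) * j x = poly f (\<sigma> * j x) * j y \<longrightarrow> y / x \<in> range \<iota>)"
    (is "?MRD \<longleftrightarrow> ?R")
proof -
  define \<phi> where "\<phi> = (\<lambda>(\<alpha>, \<beta>) x. \<alpha> * poly f (\<sigma> * j x) + \<beta> * j x)"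
  let ?C = "range \<phi>"
  have \<phi>: "\<phi> (\<alpha>, \<beta>) x = \<alpha> * poly f (\<sigma> * j x) + \<beta> * j x" for \<alpha> \<beta> x
    by (simp add: \<phi>_def)
  have code: "code_sub q t j f \<sigma> k = ?C"
    by (auto simp: code_sub_def f_sub_def j_power_multiple \<phi>_def image_def)
  have scale: "\<phi> p (\<iota> c * x) = j (\<iota> c) * \<phi> p x" for p c x
    using q_polynomial_Fq_scale[OF f, of c "\<sigma> * j x"]
    by (cases p) (simp add: \<phi> j(3) algebra_simps)
  have lin: "Vector_Spaces.linear (emb_scale \<iota>) (emb_scale (j \<circ> \<iota>)) g" if "g \<in> ?C" for g
    using that vector_spaces scale
    by (auto simp: Vector_Spaces.linear_iff emb_scale_def)
       (simp add: \<phi> j(2) distrib_left q_polynomial_add[OF q cards(3) f])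
  interpret F: vector_space "fun_scale (emb_scale (j \<circ> \<iota>)) :: 'k \<Rightarrow> ('l \<Rightarrow> 'a) \<Rightarrow> _"
    by (intro vector_space_fun_scale vector_spaces)
  have "F.subspace ?C"
  proof (rule F.subspaceI)
    show "0 \<in> ?C"
      by (rule image_eqI[of _ _ "(0, 0)"]) (auto simp: \<phi>)
  next
    fix g h assume "g \<in> ?C" "h \<in> ?C"
    then obtain \<alpha> \<beta> \<alpha>' \<beta>' where "g = \<phi> (\<alpha>, \<beta>)" "h = \<phi> (\<alpha>', \<beta>')"
      by auto
    then show "g + h \<in> ?C"
      by (intro image_eqI[of _ _ "(\<alpha> + \<alpha>', \<beta> + \<beta>')"]) (auto simp: \<phi> algebra_simps)
  next
    fix c g assume "g \<in> ?C"
    then obtain \<alpha> \<beta> where "g = \<phi> (\<alpha>, \<beta>)"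
      by auto
    then show "fun_scale (emb_scale (j \<circ> \<iota>)) c g \<in> ?C"
      by (intro image_eqI[of _ _ "(j (\<iota> c) * \<alpha>, j (\<iota> c) * \<beta>)"])
         (auto simp: \<phi> fun_scale_def emb_scale_def algebra_simps)
  qed
  \<comment> \<open>For \<open>d = t - 1\<close> the size exponent is
    \<open>n * (t - d + 1) = n * 2\<close> and the kernel bound is
    \<open>q ^ (t - d) = q\<close>.\<close>
  from MRD_code_iff_card_kernel[OF vector_spaces cards lin this, of "t - 1"]
  have MRD: "?MRD \<longleftrightarrow> card ?C = q ^ (n * 2) \<and>
      (\<exists>g\<in>?C. g \<noteq> 0 \<and> card {x. g x = 0} = q) \<and>
      (\<forall>g\<in>?C. g \<noteq> 0 \<longrightarrow> card {x. g x = 0} \<le> q)"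
    unfolding code using t by (simp add: max_absorb1 min_absorb2 mult_2_right)
  have card_pairs: "CARD('a \<times> 'a) = q ^ (n * 2)"
    by (simp add: cards mult_2_right flip: power_add)
  have card_line: "card (range (\<lambda>c. x * \<iota> c)) = q" if "x \<noteq> 0" for x
    using that iota(7) by (subst card_image) (auto simp: cards inj_on_def)
  \<comment> \<open>These coefficients are chosen to make the word vanish at \<open>x\<close>, hence
    on the whole line through \<open>x\<close> over the smallest field. Both directions use this
    word.\<close>
  have line_kernel: "range (\<lambda>c. x * \<iota> c) \<subseteq> {y. \<phi> (j x, - poly f (\<sigma> * j x)) y = 0}" for x
    using scale[of "(j x, - poly f (\<sigma> * j x))" _ x] by (auto simp: \<phi> mult.commute)
  show ?thesis
  proof
    assume ?MRD
    then have card: "card ?C = CARD('a \<times> 'a)"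
      and le: "\<And>g. g \<in> ?C \<Longrightarrow> g \<noteq> 0 \<Longrightarrow> card {x. g x = 0} \<le> q"
      unfolding MRD card_pairs by auto
    have inj: "inj \<phi>"
      using card by (intro eq_card_imp_inj_on) auto
    show ?R
    proof (intro allI impI)
      fix x y assume x: "x \<noteq> 0" and eq: "poly f (\<sigma> * j y) * j x = poly f (\<sigma> * j x) * j y"
      let ?p = "(j x, - poly f (\<sigma> * j x))"
      have "\<phi> ?p \<noteq> \<phi> (0, 0)"
        using inj x by (auto simp: inj_eq j(5))
      then have "\<phi> ?p \<noteq> 0"
        by (auto simp: fun_eq_iff \<phi>)
      \<comment> \<open>The line has \<open>q\<close> elements and lies in a kernel of at most
        \<open>q\<close> elements.\<close>
      then have "range (\<lambda>c. x * \<iota> c) = {y. \<phi> ?p y = 0}"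
        using le[of "\<phi> ?p"] line_kernel[of x] card_line[OF x] by (intro card_seteq) auto
      moreover have "\<phi> ?p y = 0"
        using eq by (simp add: \<phi> mult.commute)
      ultimately have "y \<in> range (\<lambda>c. x * \<iota> c)"
        by blast
      then show "y / x \<in> range \<iota>"
        using x by auto
    qed
  next
    assume R: ?R
    have le: "card {x. \<phi> p x = 0} \<le> q" if p: "p \<noteq> (0, 0)" for p
    proof (cases "\<exists>x. x \<noteq> 0 \<and> \<phi> p x = 0")
      case True
      then obtain x where x: "x \<noteq> 0" "\<phi> p x = 0"
        by auto
      obtain \<alpha> \<beta> where p_eq: "p = (\<alpha>, \<beta>)"
        by fastforce
      \<comment> \<open>Otherwise \<beta> * \<open>j x\<close> = 0 with \<open>x\<close> nonzero
        would make both coefficients zero.\<close>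
      have \<alpha>: "\<alpha> \<noteq> 0"
        using x p by (auto simp: p_eq \<phi> j(5))
      have "{y. \<phi> p y = 0} \<subseteq> range (\<lambda>c. x * \<iota> c)"
      proof
        fix y assume "y \<in> {y. \<phi> p y = 0}"
        then have "\<alpha> * poly f (\<sigma> * j y) = - \<beta> * j y" "\<alpha> * poly f (\<sigma> * j x) = - \<beta> * j x"
          using x by (auto simp: p_eq \<phi> eq_neg_iff_add_eq_0)
        then have "\<alpha> * (poly f (\<sigma> * j y) * j x) = \<alpha> * (poly f (\<sigma> * j x) * j y)"
          by (metis mult.assoc mult.commute)
        then have "y / x \<in> range \<iota>"
          using R x(1) \<alpha> by simp
        then obtain c where "y / x = \<iota> c"
          by auto
        then have "y = x * \<iota> c"
          using x(1) by (simp add: field_simps)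
        then show "y \<in> range (\<lambda>c. x * \<iota> c)"
          by (rule range_eqI)
      qed
      then show ?thesis
        using card_line[OF x(1)] card_mono[OF finite] by metis
    next
      case False
      then have "card {x. \<phi> p x = 0} \<le> card {0 :: 'l}"
        by (intro card_mono) auto
      then show ?thesis
        using q_gt_1 by simp
    qed
    \<comment> \<open>The zero word has a kernel of \<open>q ^ t\<close> elements, which exceeds
      \<open>q\<close> since \<open>t\<close> is at least 2. Injectivity of the parametrization
      follows.\<close>
    have nonzero: "\<phi> p \<noteq> 0" if "p \<noteq> (0, 0)" for p
    proof
      assume "\<phi> p = 0"
      then have "q ^ t \<le> q ^ 1"
        using le[OF that] by (simp add: cards)
      then show False
        using t q_gt_1 by (subst (asm) power_increasing_iff) auto
    qed
    have inj: "inj \<phi>"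
    proof (rule injI)
      fix p p' assume eq: "\<phi> p = \<phi> p'"
      obtain \<alpha> \<beta> \<alpha>' \<beta>' where p: "p = (\<alpha>, \<beta>)" "p' = (\<alpha>', \<beta>')"
        by fastforce
      have "\<phi> (\<alpha> - \<alpha>', \<beta> - \<beta>') = 0"
        using eq by (auto simp: p fun_eq_iff \<phi> algebra_simps)
      then have "(\<alpha> - \<alpha>', \<beta> - \<beta>') = (0, 0)"
        using nonzero by blast
      then show "p = p'"
        by (simp add: p)
    qed
    \<comment> \<open>The word vanishing at 1 attains the minimum distance: its kernel contains a
      line, so it has exactly \<open>q\<close> elements.\<close>
    let ?p = "(j 1, - poly f (\<sigma> * j 1))"
    have p: "?p \<noteq> (0, 0)"
      by (simp add: j(1))
    have "q \<le> card {y. \<phi> ?p y = 0}"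
      using card_mono[OF finite line_kernel[of 1]] card_line[of 1] by simp
    then have "card {y. \<phi> ?p y = 0} = q"
      using le[OF p] by simp
    then have "\<exists>g\<in>?C. g \<noteq> 0 \<and> card {x. g x = 0} = q"
      using nonzero[OF p] by blast
    moreover have "\<forall>g\<in>?C. g \<noteq> 0 \<longrightarrow> card {x. g x = 0} \<le> q"
    proof (intro ballI impI)
      fix g assume "g \<in> ?C" "g \<noteq> 0"
      then obtain p where p: "g = \<phi> p"
        by blast
      then have "p \<noteq> (0, 0)"
        using \<open>g \<noteq> 0\<close> by (auto simp: fun_eq_iff \<phi>)
      then show "card {x. g x = 0} \<le> q"
        using le p by simp
    qed
    moreover have "card ?C = q ^ (n * 2)"
      using inj by (simp add: card_image flip: card_pairs del: card_prod)
    ultimately show ?MRD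
      unfolding MRD by blast
  qed
qed

section \<open>Codes of endomorphisms of the field with \<open>q ^ 4\<close> elements\<close>

lemma MRD_code_full_iff:
  assumes t: "t = 2" and n: "n = 4" and f: "q_polynomial q f"
  shows "MRD_code (emb_scale (j \<circ> \<iota>)) (emb_scale (j \<circ> \<iota>)) (4, 4, q, 2) (code_full q f) \<longleftrightarrow>
    R_partially_scattered (range (j \<circ> \<iota>)) (range j) f" (is "?MRD \<longleftrightarrow> ?R")
proof -
  define \<phi> where "\<phi> = (\<lambda>(\<alpha>, \<beta>, \<gamma>) x. \<alpha> * poly f x + \<beta> * x + \<gamma> * x ^ (q ^ 2))"
  let ?C = "range \<phi>"
  have \<phi>: "\<phi> (\<alpha>, \<beta>, \<gamma>) x = \<alpha> * poly f x + \<beta> * x + \<gamma> * x ^ (q ^ 2)" for \<alpha> \<beta> \<gamma> x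
    by (simp add: \<phi>_def)
  have code: "code_full q f = ?C"
    by (auto simp: code_full_def \<phi>_def image_def)
  have card_a: "CARD('a) = q ^ 4"
    using cards(3) n by simp
  have scale: "\<phi> p (j (\<iota> c) * x) = j (\<iota> c) * \<phi> p x" for p c x
    using q_polynomial_Fq_scale[OF f, of c x] Fq_power[of c 2]
    by (cases p) (simp add: \<phi> power_mult_distrib algebra_simps)
  have add: "\<phi> p (x + y) = \<phi> p x + \<phi> p y" for p x y
    by (cases p) (simp add: \<phi> q_polynomial_add[OF q cards(3) f] frobenius_add[OF q cards(3)] algebra_simps)
  have diff: "\<phi> p (x - y) = \<phi> p x - \<phi> p y" for p x y
    using add[of p "x - y" y] by simp
  have \<phi>_0 [simp]: "\<phi> p 0 = 0" for p
    using diff[of p 0 0] by simp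
  have lin: "Vector_Spaces.linear (emb_scale (j \<circ> \<iota>)) (emb_scale (j \<circ> \<iota>)) g" if "g \<in> ?C" for g
    using that vector_spaces scale add by (auto simp: Vector_Spaces.linear_iff emb_scale_def)
  interpret F: vector_space "fun_scale (emb_scale (j \<circ> \<iota>)) :: 'k \<Rightarrow> ('a \<Rightarrow> 'a) \<Rightarrow> _"
    by (intro vector_space_fun_scale vector_spaces)
  have "F.subspace ?C"
  proof (rule F.subspaceI)
    show "0 \<in> ?C"
      by (rule image_eqI[of _ _ "(0, 0, 0)"]) (auto simp: \<phi>)
  next
    fix g h assume "g \<in> ?C" "h \<in> ?C"
    then obtain \<alpha> \<beta> \<gamma> \<alpha>' \<beta>' \<gamma>' where "g = \<phi> (\<alpha>, \<beta>, \<gamma>)" "h = \<phi> (\<alpha>', \<beta>', \<gamma>')"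
      by auto
    then show "g + h \<in> ?C"
      by (intro image_eqI[of _ _ "(\<alpha> + \<alpha>', \<beta> + \<beta>', \<gamma> + \<gamma>')"]) (auto simp: \<phi> algebra_simps)
  next
    fix c g assume "g \<in> ?C"
    then obtain \<alpha> \<beta> \<gamma> where "g = \<phi> (\<alpha>, \<beta>, \<gamma>)"
      by auto
    then show "fun_scale (emb_scale (j \<circ> \<iota>)) c g \<in> ?C"
      by (intro image_eqI[of _ _ "(j (\<iota> c) * \<alpha>, j (\<iota> c) * \<beta>, j (\<iota> c) * \<gamma>)"])
         (auto simp: \<phi> fun_scale_def emb_scale_def algebra_simps)
  qed
  \<comment> \<open>Here \<open>m = l = 4\<close> and \<open>d = 2\<close>, which gives the size
    exponent \<open>4 * (4 - 2 + 1) = 12\<close> and the kernel bound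
    \<open>q ^ (4 - 2)\<close>.\<close>
  from MRD_code_iff_card_kernel[OF vector_spaces(2,2) cards(1) card_a card_a lin this, of 2]
  have MRD: "?MRD \<longleftrightarrow> card ?C = q ^ 12 \<and>
      (\<exists>g\<in>?C. g \<noteq> 0 \<and> card {x. g x = 0} = q ^ 2) \<and>
      (\<forall>g\<in>?C. g \<noteq> 0 \<longrightarrow> card {x. g x = 0} \<le> q ^ 2)"
    unfolding code by simp
  have card_triples: "CARD('a \<times> 'a \<times> 'a) = q ^ 12"
    by (simp add: card_a flip: power_add)
  have j_power: "j c ^ (q ^ 2) = j c" for c
    using j_power_multiple[of c 1] t by simp
  have mem_range_j: "x \<in> range j \<longleftrightarrow> x ^ (q ^ 2) = x" for x
    using range_field_embedding[OF emb(2)] cards(2) t by auto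
  \<comment> \<open>The equation says that \<open>y / x\<close> is fixed by the power
    \<open>q ^ 2\<close>; it is also the vanishing of the determinant with rows \<open>x\<close>,
    \<open>x ^ (q ^ 2)\<close> and \<open>y\<close>, \<open>y ^ (q ^ 2)\<close>.\<close>
  have mem_line: "y \<in> range (\<lambda>c. x * j c) \<longleftrightarrow> x * y ^ (q ^ 2) = y * x ^ (q ^ 2)"
    if "x \<noteq> 0" for x y
  proof -
    have "y \<in> range (\<lambda>c. x * j c) \<longleftrightarrow> y / x \<in> range j"
      using that by (auto simp: image_iff field_simps)
    then show ?thesis
      using that by (simp add: mem_range_j power_divide field_simps)
  qed
  have card_line: "card (range (\<lambda>c. x * j c)) = q ^ 2" if "x \<noteq> 0" for x
    using that j(7) t by (subst card_image) (auto simp: cards inj_on_def)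
  have lt: "q ^ 1 < q ^ 2" "q ^ 2 < q ^ 4"
    using q_gt_1 by (simp_all only: power_strict_increasing_iff)
  show ?thesis
  proof
    assume ?MRD
    then have card: "card ?C = CARD('a \<times> 'a \<times> 'a)"
      and le: "\<And>g. g \<in> ?C \<Longrightarrow> g \<noteq> 0 \<Longrightarrow> card {x. g x = 0} \<le> q ^ 2"
      unfolding MRD card_triples by auto
    have inj: "inj \<phi>"
      using card by (intro eq_card_imp_inj_on) auto
    show ?R
      unfolding R_partially_scattered_def
    proof (intro allI impI, rule ccontr)
      fix y z assume y: "y \<noteq> 0" and z: "z \<noteq> 0" and eq: "poly f y / y = poly f z / z"
        and "y / z \<in> range j" and notin: "y / z \<notin> range (j \<circ> \<iota>)"
      then obtain c where "y / z = j c"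
        by auto
      then have c: "y = z * j c" "c \<notin> range \<iota>"
        using z notin by (auto simp: field_simps)
      \<comment> \<open>Since \<open>c\<close> lies outside the smallest field, 1 and
        \<open>c\<close> are independent; counting then shows that they span the middle
        field.\<close>
      have "inj (\<lambda>(a, b). \<iota> a + \<iota> b * c)"
      proof (rule injI, clarify)
        fix a b a' b' assume eq: "\<iota> a + \<iota> b * c = \<iota> a' + \<iota> b' * c"
        have *: "\<iota> (x - x') = \<iota> x - \<iota> x'" for x x'
          using iota(2)[of "x - x'" x'] by simp
        have "b = b'"
        proof (rule ccontr)
          assume "b \<noteq> b'"
          have "\<iota> (b - b') * c = \<iota> (a' - a)"
            using eq by (simp add: * algebra_simps)
          then have "\<iota> (b - b') * c = \<iota> (b - b') * \<iota> ((a' - a) / (b - b'))"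
            using \<open>b \<noteq> b'\<close> by (simp flip: iota(3))
          then have "c = \<iota> ((a' - a) / (b - b'))"
            using \<open>b \<noteq> b'\<close> by (simp add: iota(5))
          then show False
            using c(2) by blast
        qed
        then show "a = a' \<and> b = b'"
          using eq iota(7) by (auto dest: injD)
      qed
      then have "card (range (\<lambda>(a, b). \<iota> a + \<iota> b * c)) = CARD('l)"
        by (simp add: card_image cards t power2_eq_square)
      then have span: "range (\<lambda>(a, b). \<iota> a + \<iota> b * c) = UNIV"
        by (intro card_subset_eq) auto
      have "range (\<lambda>c. z * j c) \<noteq> UNIV"
        using card_line[OF z] card_a lt by auto
      then obtain w where w: "w \<notin> range (\<lambda>c. z * j c)"
        by auto
      \<comment> \<open>Cramer's rule for the coefficients of a code word vanishing at \<open>z\<close> and \<open>w\<close>.\<close>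
      define D where "D = z * w ^ (q ^ 2) - w * z ^ (q ^ 2)"
      define p where "p = (D, poly f w * z ^ (q ^ 2) - poly f z * w ^ (q ^ 2),
        w * poly f z - z * poly f w)"
      \<comment> \<open>\<open>D\<close> is the determinant of the linear system and also the
        coefficient of \<open>f\<close>; it is nonzero because \<open>w\<close> is off the line
        through \<open>z\<close>.\<close>
      have "D \<noteq> 0"
        using w mem_line[OF z] by (simp add: D_def)
      have "\<phi> p \<noteq> \<phi> (0, 0, 0)"
        using inj \<open>D \<noteq> 0\<close> by (auto simp: inj_eq p_def)
      then have nonzero: "\<phi> p \<noteq> 0"
        by (auto simp: fun_eq_iff \<phi>)
      have "\<phi> p z = 0" "\<phi> p w = 0"
        by (simp_all add: p_def D_def \<phi> algebra_simps)
      \<comment> \<open>At \<open>z\<close>, \<open>f\<close> commutes with multiplication by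
        \<open>j c\<close>, as the other two terms always do. Vanishing at \<open>z\<close>
        therefore passes to \<open>y\<close>, and then to the line that \<open>z\<close> and
        \<open>y\<close> span.\<close>
      have "poly f y = poly f z * j c"
        using eq y z c by (simp add: field_simps j(5))
      then have "\<phi> p y = j c * \<phi> p z"
        by (simp add: p_def \<phi> c power_mult_distrib j_power algebra_simps)
      then have "\<phi> p y = 0"
        using \<open>\<phi> p z = 0\<close> by simp
      have "\<phi> p (z * j x) = 0" for x
      proof -
        obtain a b where "x = \<iota> a + \<iota> b * c"
          using span by (metis (no_types, lifting) UNIV_I case_prod_conv imageE surj_pair)
        then have "z * j x = j (\<iota> a) * z + j (\<iota> b) * y"
          by (simp add: j(2,3) c algebra_simps)
        then show ?thesis
          using \<open>\<phi> p z = 0\<close> \<open>\<phi> p y = 0\<close> by (simp add: add scale)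
      qed
      \<comment> \<open>The line and the extra point \<open>w\<close> make \<open>q ^ 2 + 1\<close>
        zeros, one too many.\<close>
      then have "insert w (range (\<lambda>c. z * j c)) \<subseteq> {x. \<phi> p x = 0}"
        using \<open>\<phi> p w = 0\<close> by auto
      then have "card (insert w (range (\<lambda>c. z * j c))) \<le> card {x. \<phi> p x = 0}"
        by (intro card_mono) auto
      also have "\<dots> \<le> q ^ 2"
        using nonzero by (intro le) auto
      finally show False
        using w card_line[OF z] by simp
    qed
  next
    assume R: ?R
    \<comment> \<open>A single \<open>c\<close> outside the smallest field is fixed; the
      contradiction below will place it inside.\<close>
    have "range \<iota> \<noteq> UNIV"
    proof
      assume *: "range \<iota> = UNIV"
      have "card (range \<iota>) = q"
        using iota(7) by (simp add: card_image cards)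
      then show False
        using * lt cards(2) t by simp
    qed
    then obtain c where c: "c \<notin> range \<iota>"
      by auto
    have le: "card {x. \<phi> p x = 0} \<le> q ^ 2" if nz: "p \<noteq> (0, 0, 0)" for p
    proof (rule ccontr)
      let ?W = "{x. \<phi> p x = 0}"
      assume "\<not> card ?W \<le> q ^ 2"
      then have W: "q ^ 2 < card ?W"
        by simp
      obtain \<alpha> \<beta> \<gamma> where p: "p = (\<alpha>, \<beta>, \<gamma>)"
        by (cases p)
      show False
      \<comment> \<open>Without the \<open>f\<close>-term, any two nonzero zeros give the same value
        of \<open>x ^ (q ^ 2) / x\<close>, so the kernel lies on one line over the middle
        field.\<close>
      proof (cases "\<alpha> = 0")
        case True
        have "\<not> ?W \<subseteq> {0}"
        proof
          assume "?W \<subseteq> {0}"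
          then have "card ?W \<le> 1"
            using card_mono[of "{0}" ?W] by simp
          moreover have "1 < q ^ 2"
            using q_gt_1 by (intro one_less_power) auto
          ultimately show False
            using W by simp
        qed
        then obtain x where x: "x \<noteq> 0" "\<phi> p x = 0"
          by auto
        have \<gamma>: "\<gamma> \<noteq> 0"
          using x nz True by (auto simp: p \<phi>)
        have "?W \<subseteq> range (\<lambda>c. x * j c)"
        proof
          fix y assume "y \<in> ?W"
          then have *: "\<gamma> * y ^ (q ^ 2) = - \<beta> * y" "\<gamma> * x ^ (q ^ 2) = - \<beta> * x"
            using x True by (auto simp: p \<phi> eq_neg_iff_add_eq_0 add.commute)
          have "\<gamma> * (x * y ^ (q ^ 2)) = x * (\<gamma> * y ^ (q ^ 2))"
            by (rule mult.left_commute)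
          also have "\<dots> = y * (\<gamma> * x ^ (q ^ 2))"
            unfolding * by (simp add: mult.left_commute mult.commute)
          also have "\<dots> = \<gamma> * (y * x ^ (q ^ 2))"
            by (rule mult.left_commute)
          finally have "\<gamma> * (x * y ^ (q ^ 2)) = \<gamma> * (y * x ^ (q ^ 2))" .
          then show "y \<in> range (\<lambda>c. x * j c)"
            using \<gamma> mem_line[OF x(1)] by simp
        qed
        then have "card ?W \<le> q ^ 2"
          using card_line[OF x(1)] card_mono[OF finite] by metis
        then show False
          using W by simp
      next
        case False
        \<comment> \<open>By pigeonhole, the kernel meets its multiple by \<open>j c\<close> in a nonzero element.\<close>
        have "q ^ 4 = q ^ 2 * q ^ 2"
          by (simp flip: power_add)
        also have "\<dots> < card ?W * card ?W"
          using W by (intro mult_strict_mono) auto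
        finally have "CARD('a) < card (?W \<times> ?W)"
          by (simp add: card_a card_cartesian_product)
        then have "\<not> inj_on (\<lambda>(u, v). u - j c * v) (?W \<times> ?W)"
          using card_inj_on_le[of _ "?W \<times> ?W" "UNIV :: 'a set"] by (metis finite leD subset_UNIV)
        then obtain u v u' v' where uv: "u \<in> ?W" "v \<in> ?W" "u' \<in> ?W" "v' \<in> ?W"
          "(u, v) \<noteq> (u', v')" "u - j c * v = u' - j c * v'"
          by (auto simp: inj_on_def)
        define s where "s = v - v'"
        have cs: "j c * s = u - u'"
          using uv(6) by (simp add: s_def algebra_simps)
        \<comment> \<open>If \<open>v = v'\<close>, then \<open>cs\<close> gives
          \<open>u = u'\<close> as well, so the two pairs would coincide.\<close>
        have "s \<noteq> 0"
          using uv(5) cs by (auto simp: s_def)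
        have "\<phi> p s = 0"
          using uv by (simp add: s_def diff)
        have "\<phi> p (j c * s) = 0"
          using uv by (simp add: cs diff)
        \<comment> \<open>The terms with \<beta> and \<gamma> commute with multiplication by
          \<open>j c\<close>. Comparing the zeros \<open>s\<close> and \<open>j c * s\<close> forces
          the same of \<open>f\<close> at \<open>s\<close>.\<close>
        then have "\<alpha> * poly f (j c * s) + j c * (\<beta> * s + \<gamma> * s ^ (q ^ 2)) = 0"
          by (simp add: p \<phi> power_mult_distrib j_power algebra_simps)
        moreover have "\<beta> * s + \<gamma> * s ^ (q ^ 2) = - (\<alpha> * poly f s)"
          using \<open>\<phi> p s = 0\<close> by (simp add: p \<phi> eq_neg_iff_add_eq_0 add_ac)
        ultimately have "\<alpha> * poly f (j c * s) = \<alpha> * (j c * poly f s)"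
          by (simp add: algebra_simps)
        then have "poly f (s * j c) * j 1 = poly f (s * j 1) * j c"
          using False by (simp add: j(1) mult.commute)
        then have "c / 1 \<in> range \<iota>"
          using R \<open>s \<noteq> 0\<close> unfolding R_partially_scattered_iff by (metis zero_neq_one)
        then show False
          using c by simp
      qed
    qed
    have nonzero: "\<phi> p \<noteq> 0" if "p \<noteq> (0, 0, 0)" for p
      using le[OF that] lt card_a by auto
    have inj: "inj \<phi>"
    proof (rule injI)
      fix p p' assume eq: "\<phi> p = \<phi> p'"
      obtain \<alpha> \<beta> \<gamma> \<alpha>' \<beta>' \<gamma>' where p: "p = (\<alpha>, \<beta>, \<gamma>)" "p' = (\<alpha>', \<beta>', \<gamma>')"
        by (cases p, cases p')
      have "\<phi> (\<alpha> - \<alpha>', \<beta> - \<beta>', \<gamma> - \<gamma>') = 0"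
        using eq by (auto simp: p fun_eq_iff \<phi> algebra_simps)
      then have "(\<alpha> - \<alpha>', \<beta> - \<beta>', \<gamma> - \<gamma>') = (0, 0, 0)"
        using nonzero by blast
      then show "p = p'"
        by (simp add: p)
    qed
    \<comment> \<open>The word \<open>x ^ (q ^ 2) - x\<close> attains the minimum distance: its
      kernel is the middle field.\<close>
    have "{x. \<phi> (0, -1, 1) x = 0} = range j"
      using mem_range_j by (auto simp: \<phi>)
    then have "card {x. \<phi> (0, -1, 1) x = 0} = q ^ 2"
      using j(7) by (simp add: card_image cards t)
    then have "\<exists>g\<in>?C. g \<noteq> 0 \<and> card {x. g x = 0} = q ^ 2"
      using nonzero[of "(0, -1, 1)"] by (intro bexI[of _ "\<phi> (0, -1, 1)"]) auto
    moreover have "\<forall>g\<in>?C. g \<noteq> 0 \<longrightarrow> card {x. g x = 0} \<le> q ^ 2"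
    proof (intro ballI impI)
      fix g assume "g \<in> ?C" "g \<noteq> 0"
      then obtain p where p: "g = \<phi> p"
        by blast
      then have "p \<noteq> (0, 0, 0)"
        using \<open>g \<noteq> 0\<close> by (auto simp: fun_eq_iff \<phi>)
      then show "card {x. g x = 0} \<le> q ^ 2"
        using le p by simp
    qed
    moreover have "card ?C = q ^ 12"
      using inj by (simp add: card_image flip: card_triples del: card_prod)
    ultimately show ?MRD
      unfolding MRD by blast
  qed
qed

end

theorem theorem3p3:
  fixes q t t' n :: nat
    and \<iota> :: "'k::{field,finite} \<Rightarrow> 'l::{field,finite}"
    and j :: "'l \<Rightarrow> 'a::{field,finite}"
    and a :: "nat \<Rightarrow> 'a" and f :: "'a poly"
  assumes "primepow q" and "t \<ge> 2" and "t' \<ge> 2" and "n = t * t'"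
    and "CARD('k) = q" and "CARD('l) = q ^ t" and "CARD('a) = q ^ n"
    and "field_embedding \<iota>" and "field_embedding j"
    and "f = (\<Sum>i<n. monom (a i) (q ^ i))"
  shows "(\<forall>k::nat. R_partially_scattered (range (j \<circ> \<iota>)) (range j) f \<longleftrightarrow>
            (\<forall>\<sigma>. \<sigma> \<noteq> 0 \<longrightarrow>
               MRD_code (emb_scale \<iota>) (emb_scale (j \<circ> \<iota>)) (n, t, q, t - 1)
                 (code_sub q t j f \<sigma> k))) \<and>
         (t = 2 \<and> t' = 2 \<longrightarrow>
            (\<forall>g. q_polynomial q g \<longrightarrow>
               (R_partially_scattered (range (j \<circ> \<iota>)) (range j) g \<longleftrightarrow>
                MRD_code (emb_scale (j \<circ> \<iota>)) (emb_scale (j \<circ> \<iota>)) (4, 4, q, 2)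
                  (code_full q g))))"
proof -
  interpret field_tower q t n \<iota> j
    using assms by unfold_locales
  have f: "q_polynomial q f"
    using assms(10) by (auto simp: q_polynomial_def)
  have "t \<le> n"
    using assms(3,4) by simp
  \<comment> \<open>The criterion of \<open>MRD_code_sub_iff\<close> is free of \<open>k\<close>;
    its conjunction over all nonzero \<sigma> is the reformulated scatteredness.\<close>
  then show ?thesis
    using MRD_code_sub_iff[OF assms(2) _ f] MRD_code_full_iff assms(4)
    unfolding R_partially_scattered_iff[of f] by simp
qed

end
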